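(* Let $n,k\in\mathbb{N}$ and $\alpha,\beta\ge0$. Let $\mathbb{M}$ be a mechanism which enables transcript compression to $b(n,k)$ bits and is also $(\alpha,\beta)$-empirically-accurate for $k$ rounds given $n$ samples. Then, for every $\delta\in[0,1]$, $\mathbb{M}$ is $\left(\alpha,\ \beta+\delta k2^{b(n,k)},\ \delta\right)$-statistically-query-accurate for $k$ rounds given $n$ samples.
   Context: Game: a (randomized) mechanism $\mathbb{M}$ receives a dataset $S\in\mathcal{X}^n$. For $i=1,\dots,k$, the adversary/analyst $\mathbb{A}$ (which sees only previous answers) picks a query $q_i:\mathcal{X}^n\to\mathbb{R}$ (measurable, with finite expectation under the underlying measure), possibly depending on all previous answers, and $\mathbb{M}$ responds with $a_i\in\mathbb{R}$, which is given to $\mathbb{A}$. The transcript is the sequence $(q_1,a_1,\dots,q_k,a_k)$. Write $q(\mu)=\mathbb{E}_{T\sim\mu}[q(T)]$. $\mathbb{M}$ enables transcript compression to $b(n,k)$ bits if for every deterministic analyst $\mathbb{A}$ there is a set $\mathcal{H}_{\mathbb{A}}$ of possible transcripts with $|\mathcal{H}_{\mathbb{A}}|\le 2^{b(n,k)}$ such that for every $S\in\mathcal{X}^n$ the transcript of the interaction lies in $\mathcal{H}_{\mathbb{A}}$ with probability 1. $\mathbb{M}$ is $(\alpha,\beta)$-empirically-accurate for $k$ rounds given $n$ samples if for every $S\in\mathcal{X}^n$ and every adversary, $\Pr[\max_{i\in[k]}|q_i(S)-a_i|>\alpha]\le\beta$. For a probability measure $\mu$ over $\mathcal{X}^n$,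 a query $q$ and $\delta\in[0,1]$, $\gamma(q,\mu,\delta)$ is the minimal $\gamma\ge 0$ (with value $+\infty$ if none exists) such that $\Pr_{S\sim\mu}[|q(S)-q(\mu)|>\gamma]\le\delta$. $\mathbb{M}$ is $(\alpha,\beta',\delta)$-statistically-query-accurate for $k$ rounds given $n$ samples if for every probability measure $\mu$ over $\mathcal{X}^n$ and every adversary, with $S\sim\mu$, $$\Pr\left[\exists i\in[k]:\ |q_i(\mu)-a_i|>\alpha+\gamma(q_i,\mu,\delta)\right]\le\beta'.$$ *)

theory Defs
  imports "HOL-Probability.Probability"
begin

type_synonym 'x dataset = "nat \<Rightarrow> 'x"
type_synonym 'x query = "'x dataset \<Rightarrow> real"

text \<open>A transcript is the list \<open>[(q\<^sub>1, a\<^sub>1), \<dots>, (q\<^sub>k, a\<^sub>k)]\<close>, oldest round first.\<close>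
type_synonym 'x transcript = "('x query \<times> real) list"

text \<open>
  All coins of the mechanism are drawn upfront, as a seed \<open>\<omega>\<close> from a probability space \<open>W\<close>.
  A mechanism maps the seed, the dataset, the transcript so far and the current query to an answer.
  The domain \<open>\<X>\<close> is a measurable space \<open>X\<close>, of which only \<open>space\<close> and \<open>sets\<close> matter.
\<close>
type_synonym ('w, 'x) mech = "'w \<Rightarrow> 'x dataset \<Rightarrow> 'x transcript \<Rightarrow> 'x query \<Rightarrow> real"

text \<open>A deterministic analyst chooses the next query from the list of previous answers alone.\<close>
type_synonym 'x analyst = "real list \<Rightarrow> 'x query"

definition datasets :: "'x measure \<Rightarrow> nat \<Rightarrow> 'x dataset measure" where
  "datasets X n = Pi\<^sub>M {..<n} (\<lambda>_. X)"

primrec transcript :: "('w, 'x) mech \<Rightarrow> 'x analyst \<Rightarrow> 'w \<Rightarrow> 'x dataset \<Rightarrow> nat \<Rightarrow> 'x transcript" where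
  "transcript M A \<omega> S 0 = []"
| "transcript M A \<omega> S (Suc i) =
     (let h = transcript M A \<omega> S i; q = A (map snd h) in h @ [(q, M \<omega> S h q)])"

text \<open>Query and answer of round \<open>i\<close>; rounds are numbered from \<open>0\<close>.\<close>

definition query_at :: "('w, 'x) mech \<Rightarrow> 'x analyst \<Rightarrow> 'w \<Rightarrow> 'x dataset \<Rightarrow> nat \<Rightarrow> 'x query" where
  "query_at M A \<omega> S i = fst (transcript M A \<omega> S (Suc i) ! i)"

definition answer_at :: "('w, 'x) mech \<Rightarrow> 'x analyst \<Rightarrow> 'w \<Rightarrow> 'x dataset \<Rightarrow> nat \<Rightarrow> real" where
  "answer_at M A \<omega> S i = snd (transcript M A \<omega> S (Suc i) ! i)"

text \<open>
  Besides each query being measurable, the value of the query must depend measurably on the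
  dataset and the previous answers (and the analyst's coins) jointly; otherwise the query asked in
  a later round, evaluated on the random dataset, need not be a random variable.
\<close>

definition deterministic_analyst :: "'x measure \<Rightarrow> nat \<Rightarrow> nat \<Rightarrow> 'x analyst \<Rightarrow> bool" where
  "deterministic_analyst X n k A \<longleftrightarrow>
     (\<forall>i<k. (\<lambda>(v, S). A (map v [0..<i]) S)
        \<in> borel_measurable (Pi\<^sub>M {..<i} (\<lambda>_. borel) \<Otimes>\<^sub>M datasets X n))"

text \<open>
  A general, possibly randomized, adversary draws a seed \<open>r\<close> from a probability space \<open>R\<close>,
  independently of the dataset and of the mechanism's seed, and then plays \<open>A r\<close>.
\<close>
definition adversary ::
  "'x measure \<Rightarrow> nat \<Rightarrow> nat \<Rightarrow> 'r measure \<Rightarrow> ('r \<Rightarrow> 'x analyst) \<Rightarrow> bool" where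
  "adversary X n k R A \<longleftrightarrow> prob_space R \<and>
     (\<forall>i<k. (\<lambda>(r, v, S). A r (map v [0..<i]) S)
        \<in> borel_measurable (R \<Otimes>\<^sub>M (Pi\<^sub>M {..<i} (\<lambda>_. borel) \<Otimes>\<^sub>M datasets X n)))"

text \<open>
  A map \<open>M\<close> is a mechanism if its answers are random variables in every interaction. There is no
  suitable \<open>\<sigma>\<close>-algebra on the space of queries, so this is required for the answers produced
  against each adversary. The type argument, here and below, is the type of adversary seeds, over
  which a definition cannot quantify.
\<close>
definition mechanism ::
  "'r itself \<Rightarrow> 'x measure \<Rightarrow> nat \<Rightarrow> nat \<Rightarrow> 'w measure \<Rightarrow> ('w, 'x) mech \<Rightarrow> bool" where
  "mechanism _ X n k W M \<longleftrightarrow> prob_space W \<and>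
     (\<forall>(R :: 'r measure) A. adversary X n k R A \<longrightarrow>
        (\<forall>i<k. (\<lambda>(S, \<omega>, r). answer_at M (A r) \<omega> S i)
           \<in> borel_measurable (datasets X n \<Otimes>\<^sub>M (W \<Otimes>\<^sub>M R))))"

definition transcript_compression ::
  "'x measure \<Rightarrow> nat \<Rightarrow> nat \<Rightarrow> 'w measure \<Rightarrow> ('w, 'x) mech \<Rightarrow> real \<Rightarrow> bool" where
  "transcript_compression X n k W M b \<longleftrightarrow>
     (\<forall>A. deterministic_analyst X n k A \<longrightarrow>
        (\<exists>H :: 'x transcript set. finite H \<and> real (card H) \<le> 2 powr b \<and>
           (\<forall>S \<in> space (datasets X n). AE \<omega> in W. transcript M A \<omega> S k \<in> H)))"

definition empirically_accurate ::
  "'r itself \<Rightarrow> 'x measure \<Rightarrow> nat \<Rightarrow> nat \<Rightarrow> 'w measure \<Rightarrow> ('w, 'x) mech \<Rightarrow> real \<Rightarrow> real \<Rightarrow> bool" where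
  "empirically_accurate _ X n k W M \<alpha> \<beta> \<longleftrightarrow>
     (\<forall>S \<in> space (datasets X n). \<forall>(R :: 'r measure) A. adversary X n k R A \<longrightarrow>
        \<P>((\<omega>, r) in W \<Otimes>\<^sub>M R.
           \<exists>i<k. \<bar>query_at M (A r) \<omega> S i S - answer_at M (A r) \<omega> S i\<bar> > \<alpha>) \<le> \<beta>)"

definition query_mean :: "'x query \<Rightarrow> 'x dataset measure \<Rightarrow> real" where
  "query_mean q \<mu> = (\<integral>T. q T \<partial>\<mu>)"

text \<open>The tail probability is right-continuous in \<open>g\<close>, so a minimum exists as soon as some
  \<open>g\<close> qualifies.\<close>
definition query_gamma :: "'x query \<Rightarrow> 'x dataset measure \<Rightarrow> real \<Rightarrow> ereal" where
  "query_gamma q \<mu> \<delta> =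
     (let ok = (\<lambda>g::real. 0 \<le> g \<and> \<P>(S in \<mu>. \<bar>q S - query_mean q \<mu>\<bar> > g) \<le> \<delta>)
      in if \<exists>g. ok g then ereal (LEAST g. ok g) else \<infinity>)"

definition statistically_query_accurate ::
  "'r itself \<Rightarrow> 'x measure \<Rightarrow> nat \<Rightarrow> nat \<Rightarrow> 'w measure \<Rightarrow> ('w, 'x) mech
     \<Rightarrow> real \<Rightarrow> real \<Rightarrow> real \<Rightarrow> bool" where
  "statistically_query_accurate _ X n k W M \<alpha> \<beta>' \<delta> \<longleftrightarrow>
     (\<forall>\<mu> (R :: 'r measure) A.
        prob_space \<mu> \<longrightarrow> sets \<mu> = sets (datasets X n) \<longrightarrow>
        adversary X n k R A \<longrightarrow>
        (\<forall>r \<in> space R. \<forall>as. length as < k \<longrightarrow> integrable \<mu> (A r as)) \<longrightarrow>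
        \<P>((S, \<omega>, r) in \<mu> \<Otimes>\<^sub>M (W \<Otimes>\<^sub>M R).
           \<exists>i<k. ereal \<bar>query_mean (query_at M (A r) \<omega> S i) \<mu> - answer_at M (A r) \<omega> S i\<bar>
                 > ereal \<alpha> + query_gamma (query_at M (A r) \<omega> S i) \<mu> \<delta>) \<le> \<beta>')"

end

theory Submission
  imports Defs
begin

text \<open>
  If every answer is within \<open>\<alpha>\<close> of the empirical value of its query, then a statistical failure of
  the answer forces the query to deviate on the sample from its mean by more than its own
  \<open>\<gamma>\<close>. For a fixed analyst, compression leaves at most \<open>k * 2 powr b\<close> queries that are ever asked,
  and these do not depend on the sample, so a union bound over them applies. Randomized analysts are
  handled by integrating over the analyst's seed last.
\<close>

section \<open>Transcripts as sequences of queries and answers\<close>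

lemma length_transcript [simp]: "length (transcript M A \<omega> S i) = i"
  by (induction i) (simp_all add: Let_def)

lemma transcript_eq_map:
  "transcript M A \<omega> S i = map (\<lambda>j. (query_at M A \<omega> S j, answer_at M A \<omega> S j)) [0..<i]"
proof (induction i)
  case (Suc i)
  have "transcript M A \<omega> S (Suc i)
      = transcript M A \<omega> S i @ [transcript M A \<omega> S (Suc i) ! i]"
    by (simp add: Let_def nth_append)
  then show ?case
    using Suc by (simp add: query_at_def answer_at_def)
qed simp

text \<open>The dataset and the coins influence a query only through the earlier answers.
  Measurability of queries thereby reduces to that of answers and of the analyst's map.\<close>

lemma query_at_eq: "query_at M A \<omega> S i = A (map (answer_at M A \<omega> S) [0..<i])"
proof -
  have "query_at M A \<omega> S i = A (map snd (transcript M A \<omega> S i))"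
    by (simp add: query_at_def Let_def nth_append)
  then show ?thesis
    by (simp add: transcript_eq_map o_def)
qed

section \<open>Attainment of the minimum in \<open>query_gamma\<close>, and a finite union
  bound\<close>

lemma (in prob_space) prob_tail_Inf_le:
  fixes f :: "'a \<Rightarrow> real"
  assumes f [measurable]: "f \<in> borel_measurable M"
    and G: "G \<noteq> {}" "bdd_below G" "\<And>g. g \<in> G \<Longrightarrow> \<P>(x in M. f x > g) \<le> \<delta>"
  shows "\<P>(x in M. f x > Inf G) \<le> \<delta>"
proof -
  \<comment> \<open>Right continuity of the tail: the sets \<open>B n\<close> increase to the tail
    event at \<open>Inf G\<close>, so a common bound on their probabilities survives the
    limit.\<close>
  define B where "B n = {x \<in> space M. f x > Inf G + 1 / real (Suc n)}" for n :: nat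
  have "incseq B"
  proof (rule incseq_SucI)
    fix n
    have "1 / real (Suc (Suc n)) \<le> 1 / real (Suc n)"
      by (intro divide_left_mono) auto
    then show "B n \<subseteq> B (Suc n)"
      unfolding B_def by (auto simp del: of_nat_Suc)
  qed
  moreover have "range B \<subseteq> events"
    by (auto simp: B_def)
  ultimately have "(\<lambda>n. prob (B n)) \<longlonglongrightarrow> prob (\<Union>n. B n)"
    by (rule finite_Lim_measure_incseq[rotated])
  moreover have "(\<Union>n. B n) = {x \<in> space M. f x > Inf G}"
  proof (intro equalityI subsetI)
    fix x assume "x \<in> (\<Union>n. B n)"
    then obtain n where "x \<in> space M" "Inf G + 1 / real (Suc n) < f x"
      unfolding B_def by blast
    moreover have "0 < 1 / real (Suc n)" by simp
    ultimately have "x \<in> space M" "Inf G < f x"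
      by linarith+
    then show "x \<in> {x \<in> space M. f x > Inf G}" by simp
  next
    fix x assume x: "x \<in> {x \<in> space M. f x > Inf G}"
    then obtain n where "inverse (real (Suc n)) < f x - Inf G"
      using reals_Archimedean[of "f x - Inf G"] by auto
    with x have "x \<in> B n"
      by (simp add: B_def inverse_eq_divide del: of_nat_Suc)
    then show "x \<in> (\<Union>n. B n)" by blast
  qed
  moreover have "prob (B n) \<le> \<delta>" for n
  proof -
    \<comment> \<open>The threshold of \<open>B n\<close> exceeds the infimum, so some member of
      \<open>G\<close> lies below it, and the tail at that member contains
      \<open>B n\<close>.\<close>
    obtain g where g: "g \<in> G" "g < Inf G + 1 / real (Suc n)"
      using cInf_lessD[OF G(1), of "Inf G + 1 / real (Suc n)"] by auto
    have "prob (B n) \<le> \<P>(x in M. f x > g)"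
      using g by (intro finite_measure_mono) (auto simp: B_def)
    with G(3)[OF g(1)] show ?thesis by simp
  qed
  ultimately show ?thesis
    by (metis (no_types, lifting) LIMSEQ_le_const2)
qed

text \<open>If no threshold qualifies, \<open>query_gamma\<close> is infinite and the event is
  empty. Otherwise right continuity puts the infimum of the qualifying thresholds among them, so
  \<open>LEAST\<close> really denotes it and its tail bound applies.\<close>

lemma prob_deviation_gt_query_gamma_le:
  assumes "prob_space \<mu>" and q [measurable]: "q \<in> borel_measurable \<mu>" and "0 \<le> \<delta>"
  shows "\<P>(S in \<mu>. ereal \<bar>q S - query_mean q \<mu>\<bar> > query_gamma q \<mu> \<delta>) \<le> \<delta>"
proof -
  interpret prob_space \<mu> by fact
  define G where "G = {g::real. 0 \<le> g \<and> \<P>(S in \<mu>. \<bar>q S - query_mean q \<mu>\<bar> > g) \<le> \<delta>}"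
  show ?thesis
  proof (cases "G = {}")
    case True
    then have "query_gamma q \<mu> \<delta> = \<infinity>"
      by (auto simp: query_gamma_def G_def Let_def)
    then show ?thesis using \<open>0 \<le> \<delta>\<close> by simp
  next
    case False
    have bdd: "bdd_below G" by (auto simp: G_def intro!: bdd_belowI[of _ 0])
    have tail: "\<P>(S in \<mu>. \<bar>q S - query_mean q \<mu>\<bar> > Inf G) \<le> \<delta>"
      by (rule prob_tail_Inf_le[OF _ False bdd]) (auto simp: G_def)
    moreover have "0 \<le> Inf G"
      by (rule cInf_greatest[OF False]) (auto simp: G_def)
    ultimately have "Inf G \<in> G" by (simp add: G_def)
    then have "(LEAST g. g \<in> G) = Inf G"
      by (rule Least_equality) (rule cInf_lower[OF _ bdd])
    then have "query_gamma q \<mu> \<delta> = ereal (Inf G)"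
      using False by (auto simp: query_gamma_def G_def Let_def)
    then show ?thesis using tail by simp
  qed
qed

lemma (in prob_space) prob_UN_le_card_mult:
  assumes "finite I" "\<And>i. i \<in> I \<Longrightarrow> B i \<in> events" "\<And>i. i \<in> I \<Longrightarrow> prob (B i) \<le> \<delta>"
  shows "prob (\<Union>i\<in>I. B i) \<le> real (card I) * \<delta>"
proof -
  have "prob (\<Union>i\<in>I. B i) \<le> (\<Sum>i\<in>I. prob (B i))"
    using assms by (intro finite_measure_subadditive_finite) auto
  also have "\<dots> \<le> real (card I) * \<delta>"
    using assms by (intro sum_bounded_above) auto
  finally show ?thesis .
qed

section \<open>Measurability of queries and answers\<close>

lemma adversary_imp_deterministic_analyst:
  assumes "adversary X n k R A" and r: "r \<in> space R"
  shows "deterministic_analyst X n k (A r)"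
  unfolding deterministic_analyst_def
proof (intro allI impI)
  fix i assume "i < k"
  then have "(\<lambda>(r, v, S). A r (map v [0..<i]) S)
      \<in> borel_measurable (R \<Otimes>\<^sub>M (Pi\<^sub>M {..<i} (\<lambda>_. borel) \<Otimes>\<^sub>M datasets X n))"
    using assms by (auto simp: adversary_def)
  from measurable_compose[OF measurable_Pair1'[OF r] this]
  show "(\<lambda>(v, S). A r (map v [0..<i]) S)
      \<in> borel_measurable (Pi\<^sub>M {..<i} (\<lambda>_. borel) \<Otimes>\<^sub>M datasets X n)"
    by (simp add: case_prod_beta')
qed

lemma deterministic_analyst_measurable:
  assumes "deterministic_analyst X n k A" and "length as < k"
  shows "A as \<in> borel_measurable (datasets X n)"
proof -
  \<comment> \<open>Points of the product space are extensional functions, hence the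
    \<open>restrict\<close>. Reading off the coordinates below \<open>length as\<close> gives back
    \<open>as\<close>, so \<open>A as\<close> is a section of the jointly measurable map.\<close>
  let ?v = "restrict (\<lambda>j. as ! j) {..<length as}"
  have "?v \<in> space (Pi\<^sub>M {..<length as} (\<lambda>_. borel))"
    by (simp add: space_PiM)
  moreover have "(\<lambda>(v, S). A (map v [0..<length as]) S)
      \<in> borel_measurable (Pi\<^sub>M {..<length as} (\<lambda>_. borel) \<Otimes>\<^sub>M datasets X n)"
    using assms by (simp add: deterministic_analyst_def)
  ultimately have "(\<lambda>S. case (?v, S) of (v, S) \<Rightarrow> A (map v [0..<length as]) S)
      \<in> borel_measurable (datasets X n)"
    by (intro measurable_compose[OF measurable_Pair1'])
  moreover have "map ?v [0..<length as] = as"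
    by (rule nth_equalityI) auto
  ultimately show ?thesis by (simp del: map_eq_conv)
qed

lemma answer_at_measurable:
  assumes "mechanism TYPE('r) X n k W M" and "adversary X n k (R :: 'r measure) A" and "i < k"
  shows "(\<lambda>(S, \<omega>, r). answer_at M (A r) \<omega> S i)
    \<in> borel_measurable (datasets X n \<Otimes>\<^sub>M (W \<Otimes>\<^sub>M R))"
  using assms unfolding mechanism_def by blast

text \<open>Here the query varies together with the sample on which it is evaluated, so
  measurability of each single query would not suffice. The function is the jointly measurable map
  from \<open>adversary\<close>, composed with the map that sends a sample and the seeds to the
  analyst's seed, the earlier answers and the sample.\<close>

lemma query_at_measurable:
  assumes M: "mechanism TYPE('r) X n k W M" and A: "adversary X n k (R :: 'r measure) A"
    and "i < k"
  shows "(\<lambda>(S, \<omega>, r). query_at M (A r) \<omega> S i S)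
    \<in> borel_measurable (datasets X n \<Otimes>\<^sub>M (W \<Otimes>\<^sub>M R))"
proof -
  let ?N = "datasets X n \<Otimes>\<^sub>M (W \<Otimes>\<^sub>M R)"
  let ?v = "\<lambda>(S, \<omega>, r). restrict (answer_at M (A r) \<omega> S) {..<i}"
  have "(\<lambda>x. \<lambda>j\<in>{..<i}. (\<lambda>(S, \<omega>, r). answer_at M (A r) \<omega> S j) x)
      \<in> measurable ?N (Pi\<^sub>M {..<i} (\<lambda>_. borel))"
    using answer_at_measurable[OF M A] \<open>i < k\<close> by (intro measurable_restrict) auto
  then have v: "?v \<in> measurable ?N (Pi\<^sub>M {..<i} (\<lambda>_. borel))"
    by (simp add: case_prod_beta')
  have "(\<lambda>(r, v, S). A r (map v [0..<i]) S)
      \<in> borel_measurable (R \<Otimes>\<^sub>M (Pi\<^sub>M {..<i} (\<lambda>_. borel) \<Otimes>\<^sub>M datasets X n))"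
    using A \<open>i < k\<close> by (auto simp: adversary_def)
  moreover have "(\<lambda>x. (snd (snd x), ?v x, fst x))
      \<in> measurable ?N (R \<Otimes>\<^sub>M (Pi\<^sub>M {..<i} (\<lambda>_. borel) \<Otimes>\<^sub>M datasets X n))"
    using v by measurable
  ultimately have "(\<lambda>x. case (snd (snd x), ?v x, fst x) of (r, v, S) \<Rightarrow> A r (map v [0..<i]) S)
      \<in> borel_measurable ?N"
    by (rule measurable_compose[rotated])
  moreover have "map (restrict a {..<i}) [0..<i] = map a [0..<i]" for a :: "nat \<Rightarrow> real"
    by simp
  ultimately show ?thesis
    by (simp add: query_at_eq case_prod_beta' del: map_eq_conv)
qed

section \<open>Order of integration, and the union bound for a fixed analyst\<close>

lemma emeasure_triple_prob_eq_nn_integral: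
  assumes "prob_space \<mu>" "prob_space W" "prob_space R"
    and E [measurable]: "E \<in> sets (\<mu> \<Otimes>\<^sub>M (W \<Otimes>\<^sub>M R))"
  shows "emeasure (\<mu> \<Otimes>\<^sub>M (W \<Otimes>\<^sub>M R)) E
    = (\<integral>\<^sup>+r. \<integral>\<^sup>+S. \<integral>\<^sup>+\<omega>. indicator E (S, \<omega>, r) \<partial>W \<partial>\<mu> \<partial>R)"
proof -
  interpret \<mu>: prob_space \<mu> by fact
  interpret W: prob_space W by fact
  interpret R: prob_space R by fact
  interpret WR: pair_prob_space W R ..
  interpret \<mu>R: pair_sigma_finite \<mu> R ..
  let ?I = "indicator E :: _ \<Rightarrow> ennreal"
  have "emeasure (\<mu> \<Otimes>\<^sub>M (W \<Otimes>\<^sub>M R)) E = (\<integral>\<^sup>+x. ?I x \<partial>(\<mu> \<Otimes>\<^sub>M (W \<Otimes>\<^sub>M R)))"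
    by simp
  also have "\<dots> = (\<integral>\<^sup>+S. \<integral>\<^sup>+y. ?I (S, y) \<partial>(W \<Otimes>\<^sub>M R) \<partial>\<mu>)"
    by (rule WR.P.nn_integral_fst[symmetric]) measurable
  \<comment> \<open>The mechanism's coins go innermost: the null set in transcript compression may
    depend on both the sample and the analyst.\<close>
  also have "\<dots> = (\<integral>\<^sup>+S. \<integral>\<^sup>+r. \<integral>\<^sup>+\<omega>. ?I (S, \<omega>, r) \<partial>W \<partial>R \<partial>\<mu>)"
    by (intro nn_integral_cong WR.nn_integral_snd[symmetric]) measurable
  \<comment> \<open>The analyst's seed goes outermost, so that the two inner integrals concern one
    deterministic analyst.\<close>
  also have "\<dots> = (\<integral>\<^sup>+r. \<integral>\<^sup>+S. \<integral>\<^sup>+\<omega>. ?I (S, \<omega>, r) \<partial>W \<partial>\<mu> \<partial>R)"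
    by (rule \<mu>R.Fubini'[symmetric]) measurable
  finally show ?thesis .
qed

text \<open>The set \<open>H\<close> depends on the analyst but not on the sample. Hence each query
  listed in \<open>H\<close> is fixed before the sample is drawn and exceeds its own
  \<open>query_gamma\<close> with probability at most \<open>\<delta>\<close>, although the analyst
  is adaptive. Only monotonicity of the integral is applied to \<open>E\<close>, so \<open>E\<close>
  may be any set.\<close>

lemma compressed_deviation_le:
  assumes "prob_space \<mu>" and sets: "sets \<mu> = sets (datasets X n)"
    and A: "deterministic_analyst X n k A"
    and comp: "transcript_compression X n k W M b" and W: "prob_space W"
    and "0 \<le> \<delta>"
    and E: "\<And>S \<omega>. (S, \<omega>) \<in> E \<Longrightarrow> \<exists>i<k. ereal \<bar>query_at M A \<omega> S i S
        - query_mean (query_at M A \<omega> S i) \<mu>\<bar> > query_gamma (query_at M A \<omega> S i) \<mu> \<delta>"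
  shows "(\<integral>\<^sup>+S. \<integral>\<^sup>+\<omega>. indicator E (S, \<omega>) \<partial>W \<partial>\<mu>) \<le> ennreal (\<delta> * real k * 2 powr b)"
proof -
  interpret \<mu>: prob_space \<mu> by fact
  interpret W: prob_space W by fact
  obtain H where H: "finite H" "real (card H) \<le> 2 powr b"
    and AE_H: "\<And>S. S \<in> space (datasets X n) \<Longrightarrow> AE \<omega> in W. transcript M A \<omega> S k \<in> H"
    using comp[unfolded transcript_compression_def, rule_format, OF A] by auto
  \<comment> \<open>\<open>H\<close> may also contain transcripts that never occur, with
    non-measurable queries. Discarding these makes every \<open>D ti\<close> an event and loses no
    query that the analyst can ask.\<close>
  define I where "I = {(t, i) \<in> H \<times> {..<k}. fst (t ! i) \<in> borel_measurable \<mu>}"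
  define D where "D ti = (let q = fst (fst ti ! snd ti) in
      {S \<in> space \<mu>. ereal \<bar>q S - query_mean q \<mu>\<bar> > query_gamma q \<mu> \<delta>})"
    for ti :: "'a transcript \<times> nat"
  have fin: "finite (H \<times> {..<k})" using H(1) by simp
  have sub: "I \<subseteq> H \<times> {..<k}" by (auto simp: I_def)
  have I: "finite I" "card I \<le> card H * k"
    using finite_subset[OF sub fin] card_mono[OF fin sub] by (simp_all add: card_cartesian_product)
  have D_event: "D ti \<in> \<mu>.events" and D_prob: "\<mu>.prob (D ti) \<le> \<delta>" if "ti \<in> I" for ti
  proof -
    have [measurable]: "fst (fst ti ! snd ti) \<in> borel_measurable \<mu>"
      using that by (auto simp: I_def)
    show "D ti \<in> \<mu>.events"
      unfolding D_def Let_def by measurable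
    show "\<mu>.prob (D ti) \<le> \<delta>"
      unfolding D_def Let_def
      by (rule prob_deviation_gt_query_gamma_le) (use \<open>0 \<le> \<delta>\<close> \<mu>.prob_space_axioms in auto)
  qed
  \<comment> \<open>For almost all coins the transcript lies in \<open>H\<close>, so a point of
    \<open>E\<close> places \<open>S\<close> in some \<open>D ti\<close>. The resulting bound is
    free of \<open>\<omega>\<close>, and \<open>W\<close> has total mass 1.\<close>
  have "(\<integral>\<^sup>+\<omega>. indicator E (S, \<omega>) \<partial>W) \<le> indicator (\<Union>ti\<in>I. D ti) S" if S: "S \<in> space \<mu>" for S
  proof -
    have "AE \<omega> in W. indicator E (S, \<omega>) \<le> (indicator (\<Union>ti\<in>I. D ti) S :: ennreal)"
      using AE_H[OF S[unfolded sets_eq_imp_space_eq[OF sets]]]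
    proof eventually_elim
      case (elim \<omega>)
      have "S \<in> (\<Union>ti\<in>I. D ti)" if inE: "(S, \<omega>) \<in> E"
      proof -
        obtain i where i: "i < k" and gt: "ereal \<bar>query_at M A \<omega> S i S
            - query_mean (query_at M A \<omega> S i) \<mu>\<bar> > query_gamma (query_at M A \<omega> S i) \<mu> \<delta>"
          using E[OF inE] by blast
        have fst_nth: "fst (transcript M A \<omega> S k ! i) = query_at M A \<omega> S i"
          using i by (simp add: transcript_eq_map)
        have "query_at M A \<omega> S i \<in> borel_measurable \<mu>"
          unfolding query_at_eq measurable_cong_sets[OF sets refl]
          by (rule deterministic_analyst_measurable[OF A]) (simp add: i)
        then have "(transcript M A \<omega> S k, i) \<in> I"
          using elim i fst_nth by (simp add: I_def)
        moreover have "S \<in> D (transcript M A \<omega> S k, i)"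
          using gt S by (simp add: D_def fst_nth Let_def)
        ultimately show ?thesis by blast
      qed
      then show ?case by (simp add: indicator_def)
    qed
    then have "(\<integral>\<^sup>+\<omega>. indicator E (S, \<omega>) \<partial>W)
        \<le> (\<integral>\<^sup>+\<omega>. indicator (\<Union>ti\<in>I. D ti) S \<partial>W)"
      by (rule nn_integral_mono_AE)
    then show ?thesis by (simp add: W.emeasure_space_1)
  qed
  then have "(\<integral>\<^sup>+S. \<integral>\<^sup>+\<omega>. indicator E (S, \<omega>) \<partial>W \<partial>\<mu>)
      \<le> (\<integral>\<^sup>+S. indicator (\<Union>ti\<in>I. D ti) S \<partial>\<mu>)"
    by (rule nn_integral_mono)
  also have "\<dots> = ennreal (\<mu>.prob (\<Union>ti\<in>I. D ti))"
    using D_event I(1) by (subst nn_integral_indicator) (auto simp: \<mu>.emeasure_eq_measure)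
  also have "\<dots> \<le> ennreal (\<delta> * real k * 2 powr b)"
  proof (rule ennreal_leI)
    have "\<mu>.prob (\<Union>ti\<in>I. D ti) \<le> real (card I) * \<delta>"
      using I(1) D_event D_prob by (rule \<mu>.prob_UN_le_card_mult)
    also have "\<dots> \<le> (real (card H) * real k) * \<delta>"
      using I(2) \<open>0 \<le> \<delta>\<close> by (intro mult_right_mono) (metis of_nat_le_iff of_nat_mult, assumption)
    also have "\<dots> \<le> (2 powr b * real k) * \<delta>"
      using H(2) \<open>0 \<le> \<delta>\<close> by (intro mult_right_mono) auto
    finally show "\<mu>.prob (\<Union>ti\<in>I. D ti) \<le> \<delta> * real k * 2 powr b"
      by (simp add: mult_ac)
  qed
  finally show ?thesis .
qed

section \<open>Splitting statistical failure by empirical accuracy\<close>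

theorem theorem4p7:
  fixes X :: "'x measure" and W :: "'w measure" and M :: "('w, 'x) mech"
    and n k :: nat and \<alpha> \<beta> :: real and b :: "nat \<Rightarrow> nat \<Rightarrow> real"
  assumes "0 \<le> \<alpha>" and "0 \<le> \<beta>"
    and "mechanism TYPE('r) X n k W M"
    and "transcript_compression X n k W M (b n k)"
    and "empirically_accurate TYPE('r) X n k W M \<alpha> \<beta>"
  shows "\<forall>\<delta>\<in>{0..1}. statistically_query_accurate TYPE('r) X n k W M
           \<alpha> (\<beta> + \<delta> * real k * 2 powr b n k) \<delta>"
  unfolding statistically_query_accurate_def
proof (intro ballI allI impI)
  fix \<delta> :: real and \<mu> :: "'x dataset measure" and R :: "'r measure" and A
  assume \<delta>: "\<delta> \<in> {0..1}" and \<mu>: "prob_space \<mu>"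
    and sets: "sets \<mu> = sets (datasets X n)"
    and A: "adversary X n k R A"
  have W: "prob_space W" using assms by (simp add: mechanism_def)
  have R: "prob_space R" using A by (simp add: adversary_def)
  interpret \<mu>: prob_space \<mu> by fact
  interpret W: prob_space W by fact
  interpret R: prob_space R by fact
  interpret WR: pair_prob_space W R ..
  interpret P: pair_prob_space \<mu> "W \<Otimes>\<^sub>M R" ..
  let ?P = "\<mu> \<Otimes>\<^sub>M (W \<Otimes>\<^sub>M R)"
  let ?\<epsilon> = "\<delta> * real k * 2 powr b n k"
  \<comment> \<open>\<open>E\<close> is statistical failure and \<open>B\<close> is empirical
    failure. The two terms of the claimed bound come from \<open>B\<close> and from
    \<open>E - B\<close>.\<close>
  define E where "E = {(S, \<omega>, r) \<in> space ?P.
      \<exists>i<k. ereal \<bar>query_mean (query_at M (A r) \<omega> S i) \<mu> - answer_at M (A r) \<omega> S i\<bar>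
        > ereal \<alpha> + query_gamma (query_at M (A r) \<omega> S i) \<mu> \<delta>}"
  define B where "B = {(S, \<omega>, r) \<in> space ?P.
      \<exists>i<k. \<bar>query_at M (A r) \<omega> S i S - answer_at M (A r) \<omega> S i\<bar> > \<alpha>}"
  have "0 \<le> ?\<epsilon>" using \<delta> by simp
  have "measure ?P E \<le> \<beta> + ?\<epsilon>"
  proof (cases "E \<in> P.P.events")
    case False
    \<comment> \<open>A non-measurable set has the junk measure 0.\<close>
    then show ?thesis
      using \<open>0 \<le> ?\<epsilon>\<close> \<open>0 \<le> \<beta>\<close> by (simp add: measure_notin_sets)
  next
    case True
    \<comment> \<open>Unlike \<open>E\<close>, the set \<open>B\<close> involves neither
      \<open>query_mean\<close> nor \<open>query_gamma\<close>. Its measurability follows from that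
      of queries and answers, carried over to \<open>\<mu>\<close>, which has the same measurable
      sets as \<open>datasets X n\<close>.\<close>
    have sets_P: "sets ?P = sets (datasets X n \<Otimes>\<^sub>M (W \<Otimes>\<^sub>M R))"
      using sets by (intro sets_pair_measure_cong) auto
    have a [measurable]: "(\<lambda>x. answer_at M (A (snd (snd x))) (fst (snd x)) (fst x) i)
        \<in> borel_measurable ?P" if "i < k" for i
      using answer_at_measurable[OF assms(3) A that]
      by (simp add: measurable_cong_sets[OF sets_P refl] case_prod_beta')
    have q [measurable]: "(\<lambda>x. query_at M (A (snd (snd x))) (fst (snd x)) (fst x) i (fst x))
        \<in> borel_measurable ?P" if "i < k" for i
      using query_at_measurable[OF assms(3) A that]
      by (simp add: measurable_cong_sets[OF sets_P refl] case_prod_beta')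
    have "B = (\<Union>i\<in>{..<k}. {x \<in> space ?P.
        \<bar>query_at M (A (snd (snd x))) (fst (snd x)) (fst x) i (fst x)
          - answer_at M (A (snd (snd x))) (fst (snd x)) (fst x) i\<bar> > \<alpha>})"
      by (auto simp: B_def)
    also have "\<dots> \<in> P.P.events"
      by (intro sets.finite_UN)
        (auto intro!: borel_measurable_less borel_measurable_abs borel_measurable_diff a q)
    finally have B: "B \<in> P.P.events" .
    \<comment> \<open>Empirical accuracy bounds the section of \<open>B\<close> at every single
      sample, so averaging over \<open>\<mu>\<close> preserves the bound
      \<open>\<beta>\<close>.\<close>
    have "emeasure ?P B = (\<integral>\<^sup>+S. emeasure (W \<Otimes>\<^sub>M R) (Pair S -` B) \<partial>\<mu>)"
      by (rule WR.emeasure_pair_measure_alt[OF B])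
    also have "\<dots> \<le> (\<integral>\<^sup>+S. ennreal \<beta> \<partial>\<mu>)"
    proof (rule nn_integral_mono)
      fix S assume S: "S \<in> space \<mu>"
      have "S \<in> space (datasets X n)"
        using S sets_eq_imp_space_eq[OF sets] by simp
      then have "\<P>((\<omega>, r) in W \<Otimes>\<^sub>M R.
          \<exists>i<k. \<bar>query_at M (A r) \<omega> S i S - answer_at M (A r) \<omega> S i\<bar> > \<alpha>) \<le> \<beta>"
        using assms(5) A unfolding empirically_accurate_def by blast
      moreover have "Pair S -` B = {(\<omega>, r) \<in> space (W \<Otimes>\<^sub>M R).
          \<exists>i<k. \<bar>query_at M (A r) \<omega> S i S - answer_at M (A r) \<omega> S i\<bar> > \<alpha>}"
        using S by (auto simp: B_def space_pair_measure)
      ultimately have "WR.prob (Pair S -` B) \<le> \<beta>"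
        by (simp add: case_prod_beta')
      then show "emeasure (W \<Otimes>\<^sub>M R) (Pair S -` B) \<le> ennreal \<beta>"
        by (simp add: WR.P.emeasure_eq_measure ennreal_leI)
    qed
    finally have "emeasure ?P B \<le> ennreal \<beta>"
      by (simp add: \<mu>.emeasure_space_1)
    then have PB: "P.prob B \<le> \<beta>"
      using \<open>0 \<le> \<beta>\<close> by (simp add: P.P.emeasure_eq_measure)
    have "emeasure ?P (E - B)
        = (\<integral>\<^sup>+r. \<integral>\<^sup>+S. \<integral>\<^sup>+\<omega>. indicator (E - B) (S, \<omega>, r) \<partial>W \<partial>\<mu> \<partial>R)"
      using True B by (intro emeasure_triple_prob_eq_nn_integral \<mu> W R) auto
    also have "\<dots> \<le> (\<integral>\<^sup>+r. ennreal ?\<epsilon> \<partial>R)"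
    proof (rule nn_integral_mono)
      fix r assume r: "r \<in> space R"
      let ?E = "{(S, \<omega>). (S, \<omega>, r) \<in> E - B}"
      have "(\<integral>\<^sup>+S. \<integral>\<^sup>+\<omega>. indicator ?E (S, \<omega>) \<partial>W \<partial>\<mu>) \<le> ennreal ?\<epsilon>"
      proof (rule compressed_deviation_le[OF \<mu> sets
            adversary_imp_deterministic_analyst[OF A r] assms(4) W])
        fix S \<omega> assume "(S, \<omega>) \<in> ?E"
        then have "(S, \<omega>, r) \<in> E" "(S, \<omega>, r) \<notin> B" "(S, \<omega>, r) \<in> space ?P"
          by (simp_all add: E_def)
        then obtain i where i: "i < k" and
          gt: "ereal \<bar>query_mean (query_at M (A r) \<omega> S i) \<mu> - answer_at M (A r) \<omega> S i\<bar>
            > ereal \<alpha> + query_gamma (query_at M (A r) \<omega> S i) \<mu> \<delta>"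
          and le: "\<bar>query_at M (A r) \<omega> S i S - answer_at M (A r) \<omega> S i\<bar> \<le> \<alpha>"
          by (simp add: E_def B_def not_less) (meson not_less)
        \<comment> \<open>In the finite case this is the triangle inequality through the answer: a
          gap above \<open>\<alpha>\<close> plus \<open>query_gamma\<close> cannot be covered by an
          empirical error of at most \<open>\<alpha>\<close>. An infinite \<open>query_gamma\<close>
          contradicts \<open>gt\<close>.\<close>
        from gt le show "\<exists>i<k. ereal \<bar>query_at M (A r) \<omega> S i S
            - query_mean (query_at M (A r) \<omega> S i) \<mu>\<bar> > query_gamma (query_at M (A r) \<omega> S i) \<mu> \<delta>"
          by (intro exI[of _ i] conjI i)
            (cases "query_gamma (query_at M (A r) \<omega> S i) \<mu> \<delta>"; auto)
      qed (use \<delta> in auto)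
      then show "(\<integral>\<^sup>+S. \<integral>\<^sup>+\<omega>. indicator (E - B) (S, \<omega>, r) \<partial>W \<partial>\<mu>) \<le> ennreal ?\<epsilon>"
        by (simp add: indicator_def)
    qed
    finally have "emeasure ?P (E - B) \<le> ennreal ?\<epsilon>"
      by (simp add: R.emeasure_space_1)
    then have PEB: "P.prob (E - B) \<le> ?\<epsilon>"
      using \<open>0 \<le> ?\<epsilon>\<close> by (simp add: P.P.emeasure_eq_measure)
    have "P.prob E \<le> P.prob (B \<union> (E - B))"
      using True B by (intro P.P.finite_measure_mono) auto
    also have "\<dots> \<le> P.prob B + P.prob (E - B)"
      using True B by (intro measure_Un_le) auto
    finally show ?thesis using PB PEB by simp
  qed
  then show "\<P>((S, \<omega>, r) in ?P.
      \<exists>i<k. ereal \<bar>query_mean (query_at M (A r) \<omega> S i) \<mu> - answer_at M (A r) \<omega> S i\<bar>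
        > ereal \<alpha> + query_gamma (query_at M (A r) \<omega> S i) \<mu> \<delta>) \<le> \<beta> + ?\<epsilon>"
    by (simp add: E_def case_prod_beta')
qed

end
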